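(* Let $C$ be an unbounded line-free open convex set in $\mathbb{R}^d$. Then every covering of $\mathbb{R}^d$ with translates of $C$ can be split into two, and hence into infinitely many, coverings.
   Context: A set is line-free if it does not contain a full straight line. A family $\mathcal{C}$ of subsets of $\mathbb{R}^d$ is a covering of $\mathbb{R}^d$ if every point of $\mathbb{R}^d$ belongs to at least one member of $\mathcal{C}$. A covering $\mathcal{C}$ can be split into two (respectively, infinitely many) coverings if $\mathcal{C}$ can be partitioned into two (respectively, infinitely many) subfamilies, each of which is a covering of $\mathbb{R}^d$. *)

theory Defs
  imports "HOL-Analysis.Analysis" "HOL-Library.Disjoint_Sets"
begin

definition line_free :: "'a::real_vector set \<Rightarrow> bool" where
  "line_free S \<longleftrightarrow> \<not> (\<exists>x y. x \<noteq> y \<and> affine hull {x, y} \<subseteq> S)"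

definition is_covering :: "'a set set \<Rightarrow> bool" where
  "is_covering F \<longleftrightarrow> (\<forall>x. \<exists>A\<in>F. x \<in> A)"

definition translates :: "'a::ab_group_add set \<Rightarrow> 'a set set" where
  "translates S = range (\<lambda>v. (+) v ` S)"

definition splits_into_two :: "'a set set \<Rightarrow> bool" where
  "splits_into_two F \<longleftrightarrow> (\<exists>P. partition_on F P \<and> card P = 2 \<and> (\<forall>G\<in>P. is_covering G))"

definition splits_into_infinitely_many :: "'a set set \<Rightarrow> bool" where
  "splits_into_infinitely_many F \<longleftrightarrow>
     (\<exists>P. partition_on F P \<and> infinite P \<and> (\<forall>G\<in>P. is_covering G))"

end

theory Submission
  imports Defs
begin

text \<open>
  An unbounded open convex set \<open>C\<close> recedes in some direction \<open>u \<noteq> 0\<close>: from any of its points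
  one can walk arbitrarily far along \<open>u\<close> without leaving it, and the same holds for its
  translates (\<open>open_convex_unbounded_recession\<close>).  Line-freeness says that walking in the
  direction \<open>-u\<close> one eventually leaves each translate for good.

  Hence a covering by translates of \<open>C\<close> survives the loss of finitely many members
  (\<open>is_covering_diff_finite\<close>): starting from a point \<open>p\<close>, walk in the direction \<open>-u\<close> until all
  the discarded members have been left; whichever member covers the point reached is not
  discarded, and by recession it covers \<open>p\<close> too.

  As the members are open and balls are compact, this robustness allows a greedy choice of
  pairwise disjoint finite subfamilies \<open>H n\<close> such that \<open>H n\<close> covers the ball of radius \<open>n\<close>
  (\<open>disjoint_finite_subcovers\<close>).  The union of any infinitely many of the \<open>H n\<close> is a covering
  of the whole space, so distributing the indices \<open>n\<close> over infinitely many infinite classes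
  splits the covering into infinitely many coverings (\<open>covering_colouring\<close>).
\<close>

text \<open>
  The direction is a limit of normalised chords from a fixed point \<open>a\<close> to points of \<open>S\<close> that
  escape to infinity; the half-lines so obtained lie a priori only in the closure of \<open>S\<close>, but
  an open convex set is the interior of its closure.
\<close>

lemma open_convex_unbounded_recession:
  fixes S :: "'a::euclidean_space set"
  assumes "\<not> bounded S" "open S" "convex S"
  obtains u where "u \<noteq> 0" "\<And>x t. x \<in> S \<Longrightarrow> t \<ge> 0 \<Longrightarrow> x + t *\<^sub>R u \<in> S"
proof -
  from assms(1) obtain a where "a \<in> S" by fastforce
  have "\<exists>y\<in>S. norm (y - a) > real n" for n
  proof (rule ccontr)
    assume "\<not> ?thesis"
    then have "S \<subseteq> cball a (real n)"
      by (auto simp: dist_norm norm_minus_commute not_less)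
    with assms(1) show False using bounded_cball bounded_subset by blast
  qed
  then obtain y where y: "\<And>n. y n \<in> S" "\<And>n. norm (y n - a) > real n" by metis
  define r where "r n = norm (y n - a)" for n
  have r_pos: "r n > 0" for n
    using y(2)[of n] unfolding r_def by linarith
  have r_top: "filterlim r at_top sequentially"
    by (rule filterlim_at_top_mono[OF filterlim_real_sequentially])
      (use y(2) in \<open>auto simp: r_def intro!: always_eventually less_imp_le\<close>)
  define v where "v n = (1 / r n) *\<^sub>R (y n - a)" for n
  have "v n \<in> sphere 0 1" for n
    using r_pos[of n] by (auto simp: v_def r_def)
  then obtain u \<sigma> where u: "u \<in> sphere 0 1" "strict_mono (\<sigma> :: nat \<Rightarrow> nat)" "(v \<circ> \<sigma>) \<longlonglongrightarrow> u"
    using compact_sphere[of "0::'a" 1] unfolding compact_def by metis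
  have inv: "(\<lambda>n. 1 / r (\<sigma> n)) \<longlonglongrightarrow> 0"
    using filterlim_compose[OF r_top filterlim_subseq[OF u(2)]]
    by (intro tendsto_divide_0[OF tendsto_const] filterlim_at_top_imp_at_infinity)
  have in_closure: "x + t *\<^sub>R u \<in> closure S" if "x \<in> S" "t \<ge> 0" for x t
  proof -
    define z where "z n = x + (t / r (\<sigma> n)) *\<^sub>R (y (\<sigma> n) - x)" for n
    have "z = (\<lambda>n. x + t *\<^sub>R (v \<circ> \<sigma>) n + (t * (1 / r (\<sigma> n))) *\<^sub>R (a - x))"
      by (auto simp: z_def v_def algebra_simps)
    moreover have "\<dots> \<longlonglongrightarrow> x + t *\<^sub>R u + (t * 0) *\<^sub>R (a - x)"
      by (intro tendsto_intros u(3) inv)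
    ultimately have lim: "z \<longlonglongrightarrow> x + t *\<^sub>R u" by simp
    have "(\<lambda>n. t * (1 / r (\<sigma> n))) \<longlonglongrightarrow> t * 0"
      by (intro tendsto_intros inv)
    then have "\<forall>\<^sub>F n in sequentially. t * (1 / r (\<sigma> n)) < 1"
      by (rule order_tendstoD) simp
    then have "\<forall>\<^sub>F n in sequentially. z n \<in> S"
    proof eventually_elim
      case (elim n)
      have "(1 - t / r (\<sigma> n)) *\<^sub>R x + (t / r (\<sigma> n)) *\<^sub>R y (\<sigma> n) \<in> S"
        using elim r_pos[of "\<sigma> n"] that y(1) by (intro convexD[OF assms(3)]) auto
      then show ?case by (simp add: z_def algebra_simps)
    qed
    then have "\<forall>\<^sub>F n in sequentially. z n \<in> closure S"
      by eventually_elim (use closure_subset in blast)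
    then show ?thesis
      using Lim_in_closed_set[OF closed_closure _ sequentially_bot lim] by simp
  qed
  have "x + t *\<^sub>R u \<in> S" if "x \<in> S" "t \<ge> 0" for x t
  proof -
    have "open ((+) (t *\<^sub>R u) ` S)" using assms(2) by (rule open_translation)
    moreover have "(+) (t *\<^sub>R u) ` S \<subseteq> closure S"
      using in_closure that(2) by (auto simp: add.commute)
    ultimately have "(+) (t *\<^sub>R u) ` S \<subseteq> interior (closure S)" by (rule interior_maximal[rotated])
    also have "\<dots> = S"
      using convex_interior_closure[OF assms(3)] interior_open[OF assms(2)] by simp
    finally show ?thesis using that(1) by (auto simp: add.commute)
  qed
  moreover have "u \<noteq> 0" using u(1) by auto
  ultimately show thesis using that by blast
qed

lemma line_free_translation:
  assumes "line_free S"
  shows "line_free ((+) v ` S)"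
  unfolding line_free_def
proof safe
  fix x y :: 'a
  assume xy: "x \<noteq> y" "affine hull {x, y} \<subseteq> (+) v ` S"
  have "affine hull {x - v, y - v} = (+) (- v) ` (affine hull {x, y})"
    using affine_hull_translation[of "- v" "{x, y}"] by simp
  also have "\<dots> \<subseteq> (+) (- v) ` (+) v ` S"
    by (rule image_mono[OF xy(2)])
  also have "\<dots> = S" by (simp add: image_image)
  finally show False using assms xy(1) unfolding line_free_def
    by (metis diff_add_cancel)
qed

lemma line_free_leaves_backwards:
  assumes "line_free S" "u \<noteq> 0"
    and rec: "\<And>x t. x \<in> S \<Longrightarrow> t \<ge> 0 \<Longrightarrow> x + t *\<^sub>R u \<in> S"
  obtains T where "\<And>t. t \<ge> T \<Longrightarrow> p - t *\<^sub>R u \<notin> S"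
proof -
  have "\<exists>T. p - T *\<^sub>R u \<notin> S"
  proof (rule ccontr)
    assume "\<nexists>T. p - T *\<^sub>R u \<notin> S"
    then have "p + c *\<^sub>R u \<in> S" for c
      by (metis diff_minus_eq_add scaleR_minus_left)
    moreover have "\<exists>c. x = p + c *\<^sub>R u" if "x \<in> affine hull {p, p + u}" for x
    proof -
      from that obtain a b where "a + b = 1" "x = a *\<^sub>R p + b *\<^sub>R (p + u)"
        by (auto simp: affine_hull_2)
      then have "x = (a + b) *\<^sub>R p + b *\<^sub>R u" by (metis add.assoc scaleR_add_left scaleR_add_right)
      with \<open>a + b = 1\<close> show ?thesis by auto
    qed
    ultimately have "affine hull {p, p + u} \<subseteq> S" by blast
    with assms(1,2) show False unfolding line_free_def by (metis add_cancel_right_right)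
  qed
  then obtain T where T: "p - T *\<^sub>R u \<notin> S" ..
  have "p - t *\<^sub>R u \<notin> S" if "t \<ge> T" for t
    using rec[of "p - t *\<^sub>R u" "t - T"] T that by (auto simp: algebra_simps)
  then show thesis by (rule that)
qed

lemma is_covering_diff_finite:
  assumes "is_covering F" "finite G" "u \<noteq> 0"
    and lf: "\<And>A. A \<in> F \<Longrightarrow> line_free A"
    and rec: "\<And>A x t. A \<in> F \<Longrightarrow> x \<in> A \<Longrightarrow> t \<ge> 0 \<Longrightarrow> x + t *\<^sub>R u \<in> A"
  shows "is_covering (F - G)"
  unfolding is_covering_def
proof
  fix p
  have "\<exists>T. \<forall>t\<ge>T. p - t *\<^sub>R u \<notin> A" if "A \<in> F" for A
    using line_free_leaves_backwards[OF lf[OF that] assms(3) rec[OF that]] by metis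
  then obtain T where T: "\<And>A t. A \<in> F \<Longrightarrow> t \<ge> T A \<Longrightarrow> p - t *\<^sub>R u \<notin> A" by metis
  \<comment> \<open>The extra \<open>0\<close> makes sure that the walk does go backwards.\<close>
  define t where "t = Max (insert 0 (T ` G))"
  have t: "t \<ge> 0" "\<And>A. A \<in> G \<Longrightarrow> t \<ge> T A"
    using assms(2) by (auto simp: t_def)
  obtain A where A: "A \<in> F" "p - t *\<^sub>R u \<in> A"
    using assms(1) unfolding is_covering_def by blast
  with T t(2) have "A \<notin> G" by blast
  moreover have "p \<in> A" using rec[OF A t(1)] by simp
  ultimately show "\<exists>A\<in>F - G. p \<in> A" using A(1) by blast
qed

lemma disjoint_finite_subcovers:
  fixes F :: "'a::euclidean_space set set"
  assumes "\<And>A. A \<in> F \<Longrightarrow> open A"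
    and robust: "\<And>G. finite G \<Longrightarrow> is_covering (F - G)"
  obtains H :: "nat \<Rightarrow> 'a set set" where
    "disjoint_family H" "\<And>n. H n \<subseteq> F" "\<And>n. cball 0 (real n) \<subseteq> \<Union>(H n)"
proof -
  define P where "P f n r \<longleftrightarrow> finite r \<and> r \<subseteq> F - (\<Union>m<n. f m) \<and> cball 0 (real n) \<subseteq> \<Union>r"
    for f :: "nat \<Rightarrow> 'a set set" and n and r
  have "\<exists>f. \<forall>n. P f n (f n)"
  proof (rule dependent_wellorder_choice)
    fix r and f g :: "nat \<Rightarrow> 'a set set" and n :: nat
    assume "\<And>m. m < n \<Longrightarrow> f m = g m"
    then have "(\<Union>m<n. f m) = (\<Union>m<n. g m)" by auto
    then show "P f n r = P g n r" by (simp add: P_def)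
  next
    fix n :: nat and f :: "nat \<Rightarrow> 'a set set"
    assume IH: "\<And>m. m < n \<Longrightarrow> P f m (f m)"
    define R where "R = F - (\<Union>m<n. f m)"
    have "is_covering R"
      unfolding R_def using IH by (intro robust) (auto simp: P_def)
    then have "cball 0 (real n) \<subseteq> \<Union>R" by (auto simp: is_covering_def)
    moreover have "\<And>A. A \<in> R \<Longrightarrow> open A" using assms(1) by (auto simp: R_def)
    ultimately obtain r where "r \<subseteq> R" "finite r" "cball 0 (real n) \<subseteq> \<Union>r"
      using compactE[OF compact_cball] by metis
    then show "\<exists>r. P f n r" by (auto simp: P_def R_def)
  qed
  then obtain H where H: "\<And>n. P H n (H n)" by blast
  have "H m \<inter> H n = {}" if "m < n" for m n
    using H[of n] that by (auto simp: P_def)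
  then have "disjoint_family H"
    unfolding disjoint_family_on_def by (metis Int_commute linorder_neqE_nat)
  then show thesis using H by (intro that[of H]) (auto simp: P_def)
qed

text \<open>
  Colour \<open>i\<close> receives the subfamilies \<open>H n\<close> whose index \<open>n\<close> encodes a pair \<open>(i, j)\<close>; as \<open>j\<close>
  varies, these cover arbitrarily large balls.  Members of \<open>F\<close> outside all \<open>H n\<close> may get any
  colour.
\<close>

lemma covering_colouring:
  fixes F :: "'a::euclidean_space set set"
  assumes "\<And>A. A \<in> F \<Longrightarrow> open A"
    and "\<And>G. finite G \<Longrightarrow> is_covering (F - G)"
  obtains c :: "'a set \<Rightarrow> nat" where "\<And>i. is_covering {A \<in> F. c A = i}"
proof -
  obtain H :: "nat \<Rightarrow> 'a set set" where H: "disjoint_family H" "\<And>n. H n \<subseteq> F"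
    "\<And>n. cball 0 (real n) \<subseteq> \<Union>(H n)"
    using disjoint_finite_subcovers[of F] assms by blast
  define c where "c A = fst (prod_decode (SOME n. A \<in> H n))" for A
  have c: "c A = fst (prod_decode n)" if "A \<in> H n" for A n
  proof -
    from that have "A \<in> H (SOME n. A \<in> H n)" by (rule someI)
    then have "(SOME n. A \<in> H n) = n"
      using H(1) that unfolding disjoint_family_on_def by blast
    then show ?thesis by (simp add: c_def)
  qed
  have "is_covering {A \<in> F. c A = i}" for i
    unfolding is_covering_def
  proof
    fix x :: 'a
    obtain j where "norm x \<le> real j" using real_arch_simple by blast
    also have "real j \<le> real (prod_encode (i, j))" by (simp add: le_prod_encode_2)
    finally obtain A where A: "A \<in> H (prod_encode (i, j))" "x \<in> A"
      using H(3)[of "prod_encode (i, j)"] by auto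
    then have "c A = i" "A \<in> F" using c[OF A(1)] H(2) by auto
    with A(2) show "\<exists>A\<in>{A \<in> F. c A = i}. x \<in> A" by blast
  qed
  then show thesis by (rule that)
qed

lemma colouring_imp_splits:
  fixes c :: "'a set \<Rightarrow> nat"
  assumes cov: "\<And>i. is_covering {A \<in> F. c A = i}"
  shows "splits_into_two F" "splits_into_infinitely_many F"
proof -
  define Q where "Q i = {A \<in> F. c A = i}" for i
  have ne: "Q i \<noteq> {}" for i
    using cov[of i] by (auto simp: Q_def is_covering_def)
  have "inj Q"
    using ne by (intro injI) (force simp: Q_def)
  then have inf: "infinite (range Q)" by (rule range_inj_infinite)
  have "partition_on F (range Q)"
    using ne by (intro partition_onI) (auto simp: Q_def disjnt_def)
  with inf cov show "splits_into_infinitely_many F"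
    unfolding splits_into_infinitely_many_def
    by (intro exI[of _ "range Q"]) (auto simp: Q_def)
  have "partition_on F {Q 0, F - Q 0}"
  proof -
    have "Q 1 \<subseteq> F - Q 0" by (auto simp: Q_def)
    then show ?thesis
      using ne[of 0] ne[of 1] unfolding partition_on_def disjoint_def
      by (auto simp: Q_def)
  qed
  moreover have "card {Q 0, F - Q 0} = 2"
    using ne[of 0] by (subst card_2_iff) blast
  moreover have "is_covering (Q 0)" "is_covering (F - Q 0)"
    using cov[of 0] cov[of 1] unfolding Q_def is_covering_def by fastforce+
  ultimately show "splits_into_two F"
    unfolding splits_into_two_def by (intro exI[of _ "{Q 0, F - Q 0}"]) auto
qed

theorem proposition7:
  fixes C :: "(real ^ 'd) set" and F :: "(real ^ 'd) set set"
  assumes "\<not> bounded C"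
    and "line_free C"
    and "open C"
    and "convex C"
    and "F \<subseteq> translates C"
    and "is_covering F"
  shows "splits_into_two F \<and> splits_into_infinitely_many F"
proof -
  obtain u where u: "u \<noteq> 0" "\<And>x t. x \<in> C \<Longrightarrow> t \<ge> 0 \<Longrightarrow> x + t *\<^sub>R u \<in> C"
    using open_convex_unbounded_recession[OF assms(1,3,4)] by metis
  have translate: "\<exists>v. A = (+) v ` C" if "A \<in> F" for A
    using assms(5) that unfolding translates_def by blast
  have open_F: "open A" if "A \<in> F" for A
    using translate[OF that] open_translation[OF assms(3)] by blast
  have "line_free A" if "A \<in> F" for A
    using translate[OF that] line_free_translation[OF assms(2)] by blast
  moreover have "x + t *\<^sub>R u \<in> A" if "A \<in> F" "x \<in> A" "t \<ge> 0" for A x t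
    using translate[OF that(1)] that(2) u(2)[OF _ that(3)] by (force simp: add.assoc)
  ultimately have "is_covering (F - G)" if "finite G" for G
    using is_covering_diff_finite[OF assms(6) that u(1)] by blast
  with open_F obtain c :: "(real ^ 'd) set \<Rightarrow> nat" where "\<And>i. is_covering {A \<in> F. c A = i}"
    using covering_colouring[of F] by blast
  then show ?thesis using colouring_imp_splits[of F c] by blast
qed

end
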